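(* Let $X\subset\mathbb{P}^{4}$ be a smooth complex cubic threefold. A point $p\in X$ is an Eckardt point if and only if the polar quadric $\bigtriangleup_{p}(X)$ of $p$ with respect to $X$ is of rank at most two.
   Context: A smooth complex cubic threefold is a smooth hypersurface $X=\{f=0\}\subset\mathbb{P}^{4}=\mathbb{P}^{4}_{\mathbb{C}}$, where $f\in\mathbb{C}[x_{0},\ldots,x_{4}]$ is homogeneous of degree three. For $p\in X$, let $T_{p}X\subset\mathbb{P}^{4}$ denote the projective tangent space of $X$ at $p$ (a hyperplane). A point $p\in X$ is an Eckardt point if it is a point of multiplicity three of the cubic surface $X\cap T_{p}X\subset T_{p}X$. The polar quadric $\bigtriangleup_{p}(X)$ of a point $p=(p_{0}:\ldots:p_{4})\in\mathbb{P}^{4}$ with respect to $X$ is the hypersurface in $\mathbb{P}^{4}$ defined by $\sum_{i=0}^{4}p_{i}\frac{\partial f}{\partial x_{i}}=0$. Its rank is the rank of the quadratic form $\sum_{i=0}^{4}p_{i}\frac{\partial f}{\partial x_{i}}$ in $x_{0},\ldots,x_{4}$, i.e. the rank of the associated symmetric $5\times 5$ matrix. *)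

theory Defs
  imports "HOL-Analysis.Analysis" "HOL-Library.Poly_Mapping"
begin

section \<open>Complex polynomials in finitely many variables\<close>

text \<open>
  The variables are indexed by a finite type \<open>'n\<close>; for \<open>'n = 5\<close> they are
  \<open>x\<^sub>0, \<dots>, x\<^sub>4\<close>. A polynomial maps exponent vectors to coefficients.
\<close>

type_synonym 'n cpoly = "('n \<Rightarrow>\<^sub>0 nat) \<Rightarrow>\<^sub>0 complex"

definition Const :: "complex \<Rightarrow> 'n cpoly" where
  "Const c = Poly_Mapping.single 0 c"

definition Var :: "'n \<Rightarrow> 'n cpoly" where
  "Var i = Poly_Mapping.single (Poly_Mapping.single i 1) 1"

definition mdegree :: "('n::finite \<Rightarrow>\<^sub>0 nat) \<Rightarrow> nat" where
  "mdegree m = (\<Sum>i\<in>UNIV. Poly_Mapping.lookup m i)"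

definition homogeneous :: "nat \<Rightarrow> 'n::finite cpoly \<Rightarrow> bool" where
  "homogeneous d f \<longleftrightarrow> (\<forall>m\<in>Poly_Mapping.keys f. mdegree m = d)"

definition eval_poly :: "'n::finite cpoly \<Rightarrow> complex ^ 'n \<Rightarrow> complex" where
  "eval_poly f x = (\<Sum>m\<in>Poly_Mapping.keys f.
     Poly_Mapping.lookup f m * (\<Prod>i\<in>UNIV. (x $ i) ^ Poly_Mapping.lookup m i))"

definition subst_poly :: "'n::finite cpoly \<Rightarrow> ('n \<Rightarrow> 'k cpoly) \<Rightarrow> 'k cpoly" where
  "subst_poly f s = (\<Sum>m\<in>Poly_Mapping.keys f.
     Const (Poly_Mapping.lookup f m) * (\<Prod>i\<in>UNIV. s i ^ Poly_Mapping.lookup m i))"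

text \<open>
  The truncated subtraction of exponents is harmless: a monomial not containing
  \<open>x\<^sub>i\<close> gets coefficient \<open>0\<close>.
\<close>

definition partial_deriv :: "'n \<Rightarrow> 'n cpoly \<Rightarrow> 'n cpoly" where
  "partial_deriv i f = (\<Sum>m\<in>Poly_Mapping.keys f.
     Poly_Mapping.single (m - Poly_Mapping.single i 1)
       (of_nat (Poly_Mapping.lookup m i) * Poly_Mapping.lookup f m))"

text \<open>Lowest degree of a term, and \<open>\<infinity>\<close> for the zero polynomial.\<close>

definition order_at_origin :: "'k::finite cpoly \<Rightarrow> enat" where
  "order_at_origin g = (INF m\<in>Poly_Mapping.keys g. enat (mdegree m))"


section \<open>Cubic threefolds and Eckardt points\<close>

text \<open>
  Points of projective space are given by homogeneous coordinates, that is by nonzero vectors,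
  and a projective subspace by the linear subspace over it. None of the notions below depends on
  the scaling of the homogeneous coordinates.
\<close>

definition hypersurface :: "'n::finite cpoly \<Rightarrow> (complex ^ 'n) set" where
  "hypersurface f = {x. x \<noteq> 0 \<and> eval_poly f x = 0}"

definition smooth_cubic_threefold :: "5 cpoly \<Rightarrow> bool" where
  "smooth_cubic_threefold f \<longleftrightarrow> f \<noteq> 0 \<and> homogeneous 3 f \<and>
     (\<forall>x\<in>hypersurface f. \<exists>i. eval_poly (partial_deriv i f) x \<noteq> 0)"

definition tangent_space :: "'n::finite cpoly \<Rightarrow> complex ^ 'n \<Rightarrow> (complex ^ 'n) set" where
  "tangent_space f p = {y. (\<Sum>i\<in>UNIV. eval_poly (partial_deriv i f) p * y $ i) = 0}"

text \<open>
  If \<open>p, v\<^sub>1, \<dots>, v\<^sub>k\<close> is a basis of \<open>W\<close>, then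
  \<open>s \<mapsto> p + s\<^sub>1 v\<^sub>1 + \<dots> + s\<^sub>k v\<^sub>k\<close> parametrises an affine chart of the
  projective space \<open>\<P>(W)\<close>, with origin at the point \<open>p\<close>.
\<close>

definition affine_chart :: "(complex ^ 'n) set \<Rightarrow> complex ^ 'n \<Rightarrow> ('k::finite \<Rightarrow> complex ^ 'n) \<Rightarrow> bool"
  where "affine_chart W p v \<longleftrightarrow> inj v \<and> p \<notin> range v \<and>
     vec.independent (insert p (range v)) \<and> vec.span (insert p (range v)) = W"

definition local_equation ::
  "'n::finite cpoly \<Rightarrow> complex ^ 'n \<Rightarrow> ('k::finite \<Rightarrow> complex ^ 'n) \<Rightarrow> 'k cpoly" where
  "local_equation f p v =
     subst_poly f (\<lambda>i. Const (p $ i) + (\<Sum>j\<in>UNIV. Const (v j $ i) * Var j))"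

text \<open>
  For \<open>p\<close> on the cubic threefold \<open>X = {f = 0}\<close>, the multiplicity at \<open>p\<close> of the surface
  \<open>X \<inter> T\<^sub>pX\<close> in the three-dimensional projective space \<open>T\<^sub>pX\<close>. It is read off the
  equation of the surface in an affine chart of \<open>T\<^sub>pX\<close> centred at \<open>p\<close>; the choice of
  the chart does not matter.
\<close>

definition tangent_section_multiplicity :: "5 cpoly \<Rightarrow> complex ^ 5 \<Rightarrow> enat \<Rightarrow> bool" where
  "tangent_section_multiplicity f p d \<longleftrightarrow>
     (\<exists>v :: 3 \<Rightarrow> complex ^ 5. affine_chart (tangent_space f p) p v \<and>
        order_at_origin (local_equation f p v) = d)"

definition eckardt_point :: "5 cpoly \<Rightarrow> complex ^ 5 \<Rightarrow> bool" where
  "eckardt_point f p \<longleftrightarrow> p \<in> hypersurface f \<and> tangent_section_multiplicity f p 3"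


section \<open>Polar quadrics\<close>

definition polar_quadric :: "'n::finite cpoly \<Rightarrow> complex ^ 'n \<Rightarrow> 'n cpoly" where
  "polar_quadric f p = (\<Sum>i\<in>UNIV. Const (p $ i) * partial_deriv i f)"

text \<open>The symmetric matrix \<open>A\<close> with \<open>q(x) = x\<^sup>T A x\<close>, for a quadratic form \<open>q\<close>.\<close>

definition quadratic_form_matrix :: "'n::finite cpoly \<Rightarrow> complex ^ 'n ^ 'n" where
  "quadratic_form_matrix q = (\<chi> i j.
     Poly_Mapping.lookup q (Poly_Mapping.single i 1 + Poly_Mapping.single j 1) /
       (if i = j then 1 else 2))"

definition quadric_rank :: "'n::finite cpoly \<Rightarrow> nat" where
  "quadric_rank q = rank (quadratic_form_matrix q)"

end

theory Submission
  imports Defs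
begin

text \<open>
  Let \<open>T\<close> be the symmetric trilinear form with \<open>f(x) = T x x x\<close> (\<open>polarization_exists\<close>). Then the
  gradient of \<open>f\<close> at \<open>p\<close> is the functional \<open>3 T p p y\<close> of \<open>y\<close>, the polar quadric of \<open>p\<close> is
  \<open>3 T p y y\<close>, and the tangent space \<open>W\<close> is the hyperplane \<open>T p p y = 0\<close>. In other words, \<open>W\<close> is the
  orthogonal complement of \<open>p\<close> with respect to the bilinear form \<open>b y z = 3 T p y z\<close> of the polar
  quadric, and \<open>p\<close> itself is isotropic because it lies on \<open>X\<close>.

  Expanding \<open>T\<close> at \<open>p + y\<close> for \<open>y\<close> in \<open>W\<close> leaves \<open>3 T p y y + T y y y\<close>. Hence \<open>X \<inter> T\<^sub>pX\<close> has
  multiplicity three at \<open>p\<close> iff the polar quadric vanishes on \<open>W\<close> and \<open>f\<close> does not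
  (\<open>order_local_equation_eq_3_iff\<close>). The second condition always holds, since a smooth cubic of
  this dimension contains no hyperplane (\<open>singular_point_if_vanishing_on_hyperplane\<close>).

  It remains to see that the polar quadric vanishes on \<open>W\<close> iff it has rank at most two
  (\<open>rank_le_two_iff_isotropic\<close>). As \<open>p\<close> is isotropic and, by smoothness, \<open>b p w \<noteq> 0\<close> for some \<open>w\<close>, the form
  \<open>b\<close> is nondegenerate on the plane spanned by \<open>p\<close> and \<open>w\<close>. This plane contributes rank two, and any
  vector \<open>u\<close> of \<open>W\<close> with \<open>b u u \<noteq> 0\<close> contributes one more.
\<close>


section \<open>Evaluation of polynomials\<close>

lemma sum_single_lookup_keys:
  "(\<Sum>m\<in>Poly_Mapping.keys f. Poly_Mapping.single m (Poly_Mapping.lookup f m)) = f"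
proof (rule poly_mapping_eqI)
  fix k
  have "(\<Sum>m\<in>Poly_Mapping.keys f. Poly_Mapping.lookup (Poly_Mapping.single m (Poly_Mapping.lookup f m)) k)
      = (\<Sum>m\<in>Poly_Mapping.keys f. if m = k then Poly_Mapping.lookup f k else 0)"
    by (intro sum.cong) (auto simp: lookup_single when_def)
  also have "\<dots> = Poly_Mapping.lookup f k"
    by (simp add: in_keys_iff)
  finally show "Poly_Mapping.lookup (\<Sum>m\<in>Poly_Mapping.keys f. Poly_Mapping.single m (Poly_Mapping.lookup f m)) k
      = Poly_Mapping.lookup f k"
    by (simp add: lookup_sum)
qed

text \<open>
  The terms of two polynomials can be added once both sums range over the same finite set.
\<close>

lemma eval_poly_superset:
  assumes "finite S" "Poly_Mapping.keys f \<subseteq> S"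
  shows "eval_poly f x = (\<Sum>m\<in>S. Poly_Mapping.lookup f m * (\<Prod>i\<in>UNIV. (x $ i) ^ Poly_Mapping.lookup m i))"
  unfolding eval_poly_def using assms
  by (intro sum.mono_neutral_left) (auto simp: in_keys_iff)

lemma eval_poly_zero [simp]: "eval_poly 0 x = 0"
  by (simp add: eval_poly_def)

lemma eval_poly_add: "eval_poly (f + g) x = eval_poly f x + eval_poly g x"
proof -
  let ?S = "Poly_Mapping.keys f \<union> Poly_Mapping.keys g"
  have "finite ?S" "Poly_Mapping.keys (f + g) \<subseteq> ?S" "Poly_Mapping.keys f \<subseteq> ?S" "Poly_Mapping.keys g \<subseteq> ?S"
    using keys_add[of f g] by auto
  then show ?thesis
    by (simp add: eval_poly_superset[of ?S] lookup_add distrib_right sum.distrib)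
qed

lemma eval_poly_sum: "eval_poly (\<Sum>a\<in>A. F a) x = (\<Sum>a\<in>A. eval_poly (F a) x)"
  by (induction A rule: infinite_finite_induct) (simp_all add: eval_poly_add)

lemma eval_poly_single:
  "eval_poly (Poly_Mapping.single m c) x = c * (\<Prod>i\<in>UNIV. (x $ i) ^ Poly_Mapping.lookup m i)"
  by (cases "c = 0") (simp_all add: eval_poly_def)

lemma eval_poly_mult: "eval_poly (f * g) x = eval_poly f x * eval_poly g x"
proof -
  let ?s = "\<lambda>f m. Poly_Mapping.single m (Poly_Mapping.lookup f m)"
  have "f * g = (\<Sum>m\<in>Poly_Mapping.keys f. ?s f m) * (\<Sum>m\<in>Poly_Mapping.keys g. ?s g m)"
    by (simp only: sum_single_lookup_keys)
  also have "\<dots> = (\<Sum>m\<in>Poly_Mapping.keys f. \<Sum>n\<in>Poly_Mapping.keys g. ?s f m * ?s g n)"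
    by (rule sum_product)
  finally have *: "eval_poly (f * g) x
      = (\<Sum>m\<in>Poly_Mapping.keys f. \<Sum>n\<in>Poly_Mapping.keys g. eval_poly (?s f m * ?s g n) x)"
    by (simp add: eval_poly_sum)
  have "eval_poly (Poly_Mapping.single m c * Poly_Mapping.single n d) x
      = (c * (\<Prod>i\<in>UNIV. (x $ i) ^ Poly_Mapping.lookup m i)) * (d * (\<Prod>i\<in>UNIV. (x $ i) ^ Poly_Mapping.lookup n i))"
    for m n :: "'a \<Rightarrow>\<^sub>0 nat" and c d
    by (simp add: mult_single eval_poly_single lookup_add power_add prod.distrib mult_ac)
  then show ?thesis
    unfolding * by (simp only: eval_poly_def sum_product)
qed

lemma eval_poly_Const [simp]: "eval_poly (Const c) x = c"
  by (simp add: Const_def eval_poly_single)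

lemma eval_poly_Var [simp]: "eval_poly (Var i) x = x $ i"
proof -
  have "(\<Prod>j\<in>UNIV. (x $ j) ^ Poly_Mapping.lookup (Poly_Mapping.single i 1) j) = (\<Prod>j\<in>UNIV. if j = i then x $ i else 1)"
    by (intro prod.cong) (auto simp: lookup_single when_def)
  then show ?thesis
    by (simp add: Var_def eval_poly_single)
qed

lemma eval_poly_one [simp]: "eval_poly 1 x = 1"
  using eval_poly_Const[of 1 x] by (simp add: Const_def)

lemma eval_poly_power: "eval_poly (f ^ n) x = eval_poly f x ^ n"
  by (induction n) (simp_all add: eval_poly_mult)

lemma eval_poly_prod: "eval_poly (\<Prod>a\<in>A. F a) x = (\<Prod>a\<in>A. eval_poly (F a) x)"
  by (induction A rule: infinite_finite_induct) (simp_all add: eval_poly_mult)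

lemma eval_subst_poly: "eval_poly (subst_poly f s) x = eval_poly f (\<chi> i. eval_poly (s i) x)"
  by (simp add: subst_poly_def eval_poly_sum eval_poly_mult eval_poly_prod eval_poly_power
      eval_poly_def[of f])

lemma eval_local_equation:
  "eval_poly (local_equation f p v) s = eval_poly f (p + (\<Sum>j\<in>UNIV. s $ j *s v j))"
proof -
  have "(\<chi> i. eval_poly (Const (p $ i) + (\<Sum>j\<in>UNIV. Const (v j $ i) * Var j)) s)
      = p + (\<Sum>j\<in>UNIV. s $ j *s v j)"
    by (simp add: vec_eq_iff eval_poly_add eval_poly_sum eval_poly_mult mult.commute)
  then show ?thesis
    by (simp add: local_equation_def eval_subst_poly)
qed

section \<open>The order at the origin\<close>

text \<open>
  Polynomials over an infinite field are determined by their values; this is what turns a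
  statement about values, such as \<open>T p y y = 0\<close> for all \<open>y\<close>, into one about the terms of a local
  equation. The induction removes one variable \<open>a\<close> from \<open>I\<close>: with the other variables fixed, the sum
  is a polynomial in \<open>x a\<close>, so each of its coefficients vanishes, and the induction hypothesis
  applies to the monomials with a fixed exponent of \<open>a\<close>. Exponents outside \<open>I\<close> are invisible, hence
  the requirement that the monomials in \<open>M\<close> are distinguished by their exponents in \<open>I\<close>.
\<close>

lemma monomial_functions_independent:
  fixes c :: "('i \<Rightarrow>\<^sub>0 nat) \<Rightarrow> complex"
  assumes "finite I" "finite M"
    and "\<And>m m'. m \<in> M \<Longrightarrow> m' \<in> M \<Longrightarrow>
           (\<forall>i\<in>I. Poly_Mapping.lookup m i = Poly_Mapping.lookup m' i) \<Longrightarrow> m = m'"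
    and "\<And>x. (\<Sum>m\<in>M. c m * (\<Prod>i\<in>I. x i ^ Poly_Mapping.lookup m i)) = 0"
    and "m \<in> M"
  shows "c m = 0"
  using assms
proof (induction I arbitrary: M m rule: finite_induct)
  case empty
  then have "M = {m}" by blast
  then show ?case using empty.prems(3) by simp
next
  case (insert a I)
  let ?K = "\<lambda>k. {m \<in> M. Poly_Mapping.lookup m a = k}"
  show ?case
  proof (rule insert.IH)
    show "finite (?K (Poly_Mapping.lookup m a))" "m \<in> ?K (Poly_Mapping.lookup m a)"
      using insert.prems by auto
    show "m1 = m2" if "m1 \<in> ?K (Poly_Mapping.lookup m a)" "m2 \<in> ?K (Poly_Mapping.lookup m a)"
      "\<forall>i\<in>I. Poly_Mapping.lookup m1 i = Poly_Mapping.lookup m2 i" for m1 m2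
      using that insert.prems(2)[of m1 m2] by auto
    fix x :: "'i \<Rightarrow> complex"
    define N where "N = Max ((\<lambda>m. Poly_Mapping.lookup m a) ` M)"
    have N: "Poly_Mapping.lookup m a \<le> N" if "m \<in> M" for m
      using that insert.prems(1) unfolding N_def by simp
    let ?q = "\<lambda>k. \<Sum>m\<in>?K k. c m * (\<Prod>i\<in>I. x i ^ Poly_Mapping.lookup m i)"
    have "(\<Sum>k\<le>N. ?q k * t ^ k) = 0" for t
    proof -
      have "(\<Sum>k\<le>N. ?q k * t ^ k)
          = (\<Sum>k\<le>N. \<Sum>m\<in>?K k. c m * (\<Prod>i\<in>insert a I. (x(a := t)) i ^ Poly_Mapping.lookup m i))"
      proof (intro sum.cong refl)
        fix k
        have "(\<Prod>i\<in>I. (x(a := t)) i ^ Poly_Mapping.lookup m i) = (\<Prod>i\<in>I. x i ^ Poly_Mapping.lookup m i)" for m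
          using insert.hyps(2) by (intro prod.cong) auto
        then show "?q k * t ^ k = (\<Sum>m\<in>?K k. c m * (\<Prod>i\<in>insert a I. (x(a := t)) i ^ Poly_Mapping.lookup m i))"
          unfolding sum_distrib_right using insert.hyps by (intro sum.cong) (auto simp: mult_ac)
      qed
      also have "\<dots> = (\<Sum>m\<in>M. c m * (\<Prod>i\<in>insert a I. (x(a := t)) i ^ Poly_Mapping.lookup m i))"
        using insert.prems(1) N by (intro sum.group) auto
      also have "\<dots> = 0" by (rule insert.prems(3))
      finally show ?thesis .
    qed
    then have "\<forall>k\<le>N. ?q k = 0"
      using polyfun_eq_0[of ?q N] by simp
    then show "?q (Poly_Mapping.lookup m a) = 0"
      using N[OF insert.prems(4)] by simp
  qed
qed

lemma order_at_origin_eq_enat_iff: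
  fixes g :: "'k::finite cpoly"
  shows "order_at_origin g = enat d \<longleftrightarrow>
    (\<forall>m\<in>Poly_Mapping.keys g. d \<le> mdegree m) \<and> (\<exists>m\<in>Poly_Mapping.keys g. mdegree m = d)"
proof (cases "Poly_Mapping.keys g = {}")
  case True
  then show ?thesis by (simp add: order_at_origin_def top_enat_def)
next
  case False
  have "order_at_origin g = Min ((\<lambda>m. enat (mdegree m)) ` Poly_Mapping.keys g)"
    unfolding order_at_origin_def using False by (intro cInf_eq_Min) auto
  then show ?thesis using False by (auto simp: Min_eq_iff)
qed

text \<open>
  Along the line \<open>t \<mapsto> t s\<close> the coefficient of \<open>t\<^sup>k\<close> is the value at \<open>s\<close> of the homogeneous
  component of degree \<open>k\<close>, and that component is zero iff it vanishes at every \<open>s\<close>. The order can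
  therefore be read off from the restrictions of \<open>g\<close> to lines through the origin.
\<close>

lemma order_at_origin_radial:
  fixes g :: "'k::finite cpoly" and P :: "complex ^ 'k \<Rightarrow> complex poly"
  assumes P: "\<And>s t. eval_poly g (t *s s) = poly (P s) t"
  shows "order_at_origin g = enat d \<longleftrightarrow>
    (\<forall>k<d. \<forall>s. coeff (P s) k = 0) \<and> (\<exists>s. coeff (P s) d \<noteq> 0)"
proof -
  let ?G = "\<lambda>k. {m \<in> Poly_Mapping.keys g. mdegree m = k}"
  let ?mon = "\<lambda>s m. Poly_Mapping.lookup g m * (\<Prod>i\<in>UNIV. (s $ i) ^ Poly_Mapping.lookup m i)"
  have coeff_P: "coeff (P s) k = (\<Sum>m\<in>?G k. ?mon s m)" for s k
  proof -
    have "poly (P s) t = poly (\<Sum>m\<in>Poly_Mapping.keys g. monom (?mon s m) (mdegree m)) t" for t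
      by (simp add: P[symmetric] eval_poly_def poly_sum poly_monom power_mult_distrib prod.distrib
          mdegree_def mult_ac flip: power_sum)
    then have "P s = (\<Sum>m\<in>Poly_Mapping.keys g. monom (?mon s m) (mdegree m))"
      by (intro iffD1[OF poly_eq_poly_eq_iff] ext)
    then have "coeff (P s) k = (\<Sum>m\<in>Poly_Mapping.keys g. if mdegree m = k then ?mon s m else 0)"
      by (simp only: coeff_sum coeff_monom)
    then show ?thesis
      by (simp only: sum.inter_filter finite_keys)
  qed
  have empty_iff: "(\<forall>s. coeff (P s) k = 0) \<longleftrightarrow> ?G k = {}" for k
  proof
    assume zero: "\<forall>s. coeff (P s) k = 0"
    have "Poly_Mapping.lookup g m = 0" if "m \<in> ?G k" for m
    proof (rule monomial_functions_independent[of UNIV "?G k"])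
      fix x :: "'k \<Rightarrow> complex"
      show "(\<Sum>m\<in>?G k. Poly_Mapping.lookup g m * (\<Prod>i\<in>UNIV. x i ^ Poly_Mapping.lookup m i)) = 0"
        using coeff_P[of "vec_lambda x" k] zero by simp
    qed (use that in \<open>auto intro: poly_mapping_eqI\<close>)
    then show "?G k = {}" by (auto simp: in_keys_iff)
  next
    assume "?G k = {}"
    then show "\<forall>s. coeff (P s) k = 0" by (simp only: coeff_P sum.empty simp_thms)
  qed
  have "(\<forall>m\<in>Poly_Mapping.keys g. d \<le> mdegree m) \<longleftrightarrow> (\<forall>k<d. ?G k = {})"
    by (auto simp: not_less)
  moreover have "(\<exists>m\<in>Poly_Mapping.keys g. mdegree m = d) \<longleftrightarrow> ?G d \<noteq> {}"
    by auto
  moreover have "(\<exists>s. coeff (P s) d \<noteq> 0) \<longleftrightarrow> ?G d \<noteq> {}"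
    unfolding empty_iff[symmetric] by (rule not_all[symmetric])
  ultimately show ?thesis
    by (simp only: order_at_origin_eq_enat_iff empty_iff)
qed

section \<open>Symmetric bilinear and trilinear forms\<close>

locale symmetric_bilinear =
  fixes b :: "complex ^ 'n \<Rightarrow> complex ^ 'n \<Rightarrow> complex"
  assumes add_left: "b (x + y) z = b x z + b y z"
    and scale_left: "b (c *s x) z = c * b x z"
    and sym: "b x y = b y x"
begin

lemma add_right: "b x (y + z) = b x y + b x z"
  using add_left sym by metis

lemma scale_right: "b x (c *s y) = c * b x y"
  using scale_left sym by metis

lemma zero_left [simp]: "b 0 z = 0"
  using scale_left[of 0 0 z] by simp

lemma zero_right [simp]: "b x 0 = 0"
  using sym[of x 0] by simp

lemma sum_right: "b x (\<Sum>a\<in>A. F a) = (\<Sum>a\<in>A. b x (F a))"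
  by (induction A rule: infinite_finite_induct) (simp_all add: add_right)

lemma diff_left: "b (x - y) z = b x z - b y z"
  using add_left[of "x - y" y z] by simp

lemma diff_right: "b x (y - z) = b x y - b x z"
  using diff_left sym by metis

lemma eq_sum_axis: "b x (y :: complex ^ 'n::finite) = (\<Sum>j\<in>UNIV. b x (axis j 1) * y $ j)"
proof -
  have "b x y = b x (\<Sum>j\<in>UNIV. (y $ j) *s axis j 1)"
    by (simp only: basis_expansion)
  also have "\<dots> = (\<Sum>j\<in>UNIV. b x (axis j 1) * y $ j)"
    by (simp add: sum_right scale_right mult.commute)
  finally show ?thesis .
qed

end

locale symmetric_trilinear =
  fixes T :: "complex ^ 'n \<Rightarrow> complex ^ 'n \<Rightarrow> complex ^ 'n \<Rightarrow> complex"
  assumes add: "T (x + y) z w = T x z w + T y z w"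
    and scale: "T (c *s x) z w = c * T x z w"
    and swap12: "T x y z = T y x z"
    and swap23: "T x y z = T x z y"
begin

lemma symmetric_bilinear_slice: "symmetric_bilinear (\<lambda>y z. c * T p y z)"
proof
  show "c * T p (x + y) z = c * T p x z + c * T p y z" for x y z
    by (metis add swap12 distrib_left)
  show "c * T p (d *s x) z = d * (c * T p x z)" for d x z
    by (metis scale swap12 mult.left_commute)
  show "c * T p x y = c * T p y x" for x y
    by (metis swap23)
qed

sublocale slice: symmetric_bilinear "T p" for p
  using symmetric_bilinear_slice[of 1 p] by simp

lemma cube_add:
  "T (x + y) (x + y) (x + y) = T x x x + 3 * T x x y + 3 * T x y y + T y y y"
proof -
  have "T y x x = T x x y" "T x y x = T x x y" "T y x y = T x y y" "T y y x = T x y y"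
    using swap12 swap23 by metis+
  then show ?thesis by (simp add: add slice.add_left slice.add_right)
qed

end

lemma symmetric_trilinear_plus:
  assumes "symmetric_trilinear T" "symmetric_trilinear U"
  shows "symmetric_trilinear (\<lambda>x y z. T x y z + U x y z)"
proof -
  interpret T: symmetric_trilinear T by fact
  interpret U: symmetric_trilinear U by fact
  show ?thesis
  proof
    show "T (x + y) z w + U (x + y) z w = T x z w + U x z w + (T y z w + U y z w)" for x y z w
      by (simp add: T.add U.add)
    show "T (c *s x) z w + U (c *s x) z w = c * (T x z w + U x z w)" for c x z w
      by (simp add: T.scale U.scale distrib_left)
    show "T x y z + U x y z = T y x z + U y x z" for x y z
      by (simp only: T.swap12[of x] U.swap12[of x])
    show "T x y z + U x y z = T x z y + U x z y" for x y z
      by (simp only: T.swap23[of x y] U.swap23[of x y])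
  qed
qed

section \<open>The polarization of a cubic form\<close>

text \<open>
  The form \<open>T\<close> is unique, since the second clause fixes it; the last two clauses are consequences
  that are easiest to establish together with it, one monomial at a time.
\<close>

definition polarization :: "'n::finite cpoly \<Rightarrow> (complex ^ 'n \<Rightarrow> complex ^ 'n \<Rightarrow> complex ^ 'n \<Rightarrow> complex) \<Rightarrow> bool" where
  "polarization f T \<longleftrightarrow> symmetric_trilinear T \<and>
     (\<forall>x. eval_poly f x = T x x x) \<and>
     (\<forall>l x. eval_poly (partial_deriv l f) x = 3 * T x x (axis l 1)) \<and>
     (\<forall>p a b. quadratic_form_matrix (polar_quadric f p) $ a $ b = 3 * T p (axis a 1) (axis b 1))"

lemma partial_deriv_superset:
  assumes "finite S" "Poly_Mapping.keys f \<subseteq> S"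
  shows "partial_deriv l f = (\<Sum>m\<in>S. Poly_Mapping.single (m - Poly_Mapping.single l 1)
    (of_nat (Poly_Mapping.lookup m l) * Poly_Mapping.lookup f m))"
  unfolding partial_deriv_def using assms
  by (intro sum.mono_neutral_left) (auto simp: in_keys_iff)

lemma partial_deriv_zero [simp]: "partial_deriv l 0 = 0"
  by (simp add: partial_deriv_def)

lemma partial_deriv_add: "partial_deriv l (f + g) = partial_deriv l f + partial_deriv l g"
proof -
  let ?S = "Poly_Mapping.keys f \<union> Poly_Mapping.keys g"
  have "finite ?S" "Poly_Mapping.keys (f + g) \<subseteq> ?S" "Poly_Mapping.keys f \<subseteq> ?S" "Poly_Mapping.keys g \<subseteq> ?S"
    using keys_add[of f g] by auto
  then show ?thesis
    by (simp add: partial_deriv_superset[of ?S] lookup_add distrib_left single_add sum.distrib)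
qed

lemma partial_deriv_sum: "partial_deriv l (\<Sum>a\<in>A. F a) = (\<Sum>a\<in>A. partial_deriv l (F a))"
  by (induction A rule: infinite_finite_induct) (simp_all add: partial_deriv_add)

lemma partial_deriv_single:
  "partial_deriv l (Poly_Mapping.single m c) =
     Poly_Mapping.single (m - Poly_Mapping.single l 1) (of_nat (Poly_Mapping.lookup m l) * c)"
  by (cases "c = 0") (simp_all add: partial_deriv_def)

lemma partial_deriv_Const [simp]: "partial_deriv l (Const c) = 0"
  by (simp add: Const_def partial_deriv_single)

text \<open>
  The Leibniz rule for a variable. For \<open>i = l\<close> the truncated exponent matters: if \<open>x\<^sub>l\<close> does not
  occur in a monomial, subtracting and adding its exponent does not give the monomial back, but
  then the coefficient is zero.
\<close>

lemma partial_deriv_Var_mult: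
  "partial_deriv l (Var i * f) = (if i = l then f else 0) + Var i * partial_deriv l f"
proof -
  have single: "partial_deriv l (Var i * Poly_Mapping.single m c)
      = (if i = l then Poly_Mapping.single m c else 0) + Var i * partial_deriv l (Poly_Mapping.single m c)"
    for m :: "'a \<Rightarrow>\<^sub>0 nat" and c
  proof (cases "i = l")
    case True
    have "Poly_Mapping.single l 1 + (m - Poly_Mapping.single l 1) = m" if "Poly_Mapping.lookup m l \<noteq> 0"
      using that by (intro poly_mapping_eqI) (auto simp: lookup_add lookup_minus lookup_single when_def)
    then show ?thesis
      using True by (cases "Poly_Mapping.lookup m l = 0")
        (auto simp: Var_def mult_single partial_deriv_single lookup_add distrib_right single_add)
  next
    case False
    have "Poly_Mapping.single i 1 + m - Poly_Mapping.single l 1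
        = Poly_Mapping.single i 1 + (m - Poly_Mapping.single l 1)"
      using False by (intro poly_mapping_eqI) (auto simp: lookup_add lookup_minus lookup_single when_def)
    then show ?thesis
      using False by (simp add: Var_def mult_single partial_deriv_single lookup_add lookup_single)
  qed
  let ?s = "\<lambda>m. Poly_Mapping.single m (Poly_Mapping.lookup f m)"
  have "partial_deriv l (Var i * (\<Sum>m\<in>Poly_Mapping.keys f. ?s m))
      = (if i = l then (\<Sum>m\<in>Poly_Mapping.keys f. ?s m) else 0)
        + Var i * partial_deriv l (\<Sum>m\<in>Poly_Mapping.keys f. ?s m)"
    by (simp add: sum_distrib_left partial_deriv_sum single sum.distrib)
  then show ?thesis by (simp only: sum_single_lookup_keys)
qed

lemma mdegree_Suc_split:
  assumes "mdegree m = Suc d"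
  obtains i m' where "m = Poly_Mapping.single i 1 + m'" "mdegree m' = d"
proof -
  from assms obtain i where i: "Poly_Mapping.lookup m i \<noteq> 0"
    unfolding mdegree_def by (metis nat.distinct(1) sum.neutral)
  let ?m = "m - Poly_Mapping.single i 1"
  have m: "m = Poly_Mapping.single i 1 + ?m"
    using i by (intro poly_mapping_eqI) (auto simp: lookup_add lookup_minus lookup_single when_def)
  have "mdegree (Poly_Mapping.single i 1 + ?m) = 1 + mdegree ?m"
    by (simp add: mdegree_def lookup_add sum.distrib lookup_single when_def)
  with assms m have "mdegree ?m = d" by simp
  with m that show thesis by blast
qed

lemma homogeneous_cubic_induct [consumes 1, case_names zero add monomial]:
  assumes hom: "homogeneous 3 f"
    and zero: "P 0" and add: "\<And>f g. P f \<Longrightarrow> P g \<Longrightarrow> P (f + g)"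
    and monomial: "\<And>c i j k. P (Const c * Var i * Var j * Var k)"
  shows "P f"
proof -
  have single: "P (Poly_Mapping.single m c)" if m: "mdegree m = 3" for m c
  proof -
    obtain i m1 where 1: "m = Poly_Mapping.single i 1 + m1" "mdegree m1 = 2"
      by (rule mdegree_Suc_split[of m 2]) (simp add: m)
    obtain j m2 where 2: "m1 = Poly_Mapping.single j 1 + m2" "mdegree m2 = 1"
      by (rule mdegree_Suc_split[of m1 1]) (simp add: 1(2))
    obtain k m3 where 3: "m2 = Poly_Mapping.single k 1 + m3" "mdegree m3 = 0"
      by (rule mdegree_Suc_split[of m2 0]) (simp add: 2(2))
    from 3(2) have "m3 = 0" by (intro poly_mapping_eqI) (simp add: mdegree_def)
    then have "Poly_Mapping.single m c = Const c * Var i * Var j * Var k"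
      using 1 2 3 by (simp add: Const_def Var_def mult_single add_ac)
    then show ?thesis using monomial by simp
  qed
  have "P (\<Sum>m\<in>A. Poly_Mapping.single m (Poly_Mapping.lookup f m))"
    if "finite A" "A \<subseteq> Poly_Mapping.keys f" for A
    using that
  proof (induction A rule: finite_induct)
    case (insert m A)
    then show ?case using hom add single by (simp add: homogeneous_def)
  qed (simp add: zero)
  from this[of "Poly_Mapping.keys f"] show ?thesis by (simp add: sum_single_lookup_keys)
qed

lemma single_add_single_eq_iff:
  "Poly_Mapping.single j 1 + Poly_Mapping.single k 1 = Poly_Mapping.single a 1 + Poly_Mapping.single b (1::nat)
     \<longleftrightarrow> (j = a \<and> k = b) \<or> (j = b \<and> k = a)" (is "?l = ?r \<longleftrightarrow> _")
proof
  assume "?l = ?r"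
  then have "Poly_Mapping.lookup ?l x = Poly_Mapping.lookup ?r x" for x by simp
  from this[of j] this[of k] this[of a] this[of b]
  show "(j = a \<and> k = b) \<or> (j = b \<and> k = a)"
    by (auto simp: lookup_add lookup_single when_def split: if_splits)
qed (auto simp: add.commute)

lemma quadratic_form_matrix_add:
  "quadratic_form_matrix (q + r) = quadratic_form_matrix q + quadratic_form_matrix r"
  by (simp add: quadratic_form_matrix_def vec_eq_iff lookup_add add_divide_distrib)

lemma quadratic_form_matrix_monomial:
  "quadratic_form_matrix (Const c * Var j * Var k) $ a $ b =
     c / 2 * (axis a 1 $ j * axis b 1 $ k + axis b 1 $ j * axis a 1 $ k)"
proof -
  have "Const c * Var j * Var k = Poly_Mapping.single (Poly_Mapping.single j 1 + Poly_Mapping.single k 1) c"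
    by (simp add: Const_def Var_def mult_single)
  then show ?thesis
    using single_add_single_eq_iff[of j k a b]
    by (auto simp: quadratic_form_matrix_def lookup_single when_def axis_def)
qed

lemma polar_quadric_add: "polar_quadric (f + g) p = polar_quadric f p + polar_quadric g p"
  by (simp add: polar_quadric_def partial_deriv_add distrib_left sum.distrib)

lemma Const_mult: "Const (a * b) = Const a * Const b"
  by (simp add: Const_def mult_single)

lemma partial_deriv_monomial:
  "partial_deriv l (Const c * Var i * Var j * Var k) =
     (if l = i then Const c * Var j * Var k else 0) + (if l = j then Const c * Var i * Var k else 0)
     + (if l = k then Const c * Var i * Var j else 0)"
proof -
  have "Const c * Var i * Var j * Var k = Var i * (Var j * (Var k * Const c))"
    by (simp add: mult_ac)
  then show ?thesis
    by (simp only: partial_deriv_Var_mult partial_deriv_Const) (auto simp: algebra_simps)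
qed

lemma polar_quadric_monomial:
  "polar_quadric (Const c * Var i * Var j * Var k) p =
     Const (c * p $ i) * Var j * Var k + Const (c * p $ j) * Var i * Var k + Const (c * p $ k) * Var i * Var j"
proof -
  have "Const (p $ l) * partial_deriv l (Const c * Var i * Var j * Var k) =
     (if l = i then Const (c * p $ i) * Var j * Var k else 0)
     + (if l = j then Const (c * p $ j) * Var i * Var k else 0)
     + (if l = k then Const (c * p $ k) * Var i * Var j else 0)" for l
    unfolding partial_deriv_monomial by (simp add: distrib_left Const_mult mult_ac)
  then show ?thesis by (simp add: polar_quadric_def sum.distrib)
qed

text \<open>
  All clauses of \<open>polarization\<close> are additive in the cubic, so monomials suffice, and for
  \<open>c x\<^sub>i x\<^sub>j x\<^sub>k\<close> the average over the permutations of the three arguments does it.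
\<close>

lemma polarization_exists:
  assumes "homogeneous 3 f"
  shows "\<exists>T. polarization f T"
  using assms
proof (induction rule: homogeneous_cubic_induct)
  case zero
  show ?case
    by (rule exI[of _ "\<lambda>_ _ _. 0"])
      (simp add: polarization_def symmetric_trilinear_def polar_quadric_def quadratic_form_matrix_def)
next
  case (add f g)
  then obtain T U where "polarization f T" "polarization g U" by blast
  then have "polarization (f + g) (\<lambda>x y z. T x y z + U x y z)"
    unfolding polarization_def
    by (auto simp: eval_poly_add partial_deriv_add polar_quadric_add quadratic_form_matrix_add
        distrib_left intro: symmetric_trilinear_plus)
  then show ?case by blast
next
  case (monomial c i j k)
  let ?T = "\<lambda>x y z. c / 6 * (x $ i * y $ j * z $ k + x $ i * y $ k * z $ j + x $ j * y $ i * z $ k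
      + x $ j * y $ k * z $ i + x $ k * y $ i * z $ j + x $ k * y $ j * z $ i)"
  have "polarization (Const c * Var i * Var j * Var k) ?T"
    unfolding polarization_def
  proof (intro conjI allI)
    show "symmetric_trilinear ?T"
      by unfold_locales (simp_all add: algebra_simps)
  next
    show "eval_poly (Const c * Var i * Var j * Var k) x = ?T x x x" for x
      by (simp add: eval_poly_mult)
  next
    show "eval_poly (partial_deriv l (Const c * Var i * Var j * Var k)) x = 3 * ?T x x (axis l 1)" for l x
      unfolding partial_deriv_monomial
      by (auto simp: eval_poly_add eval_poly_mult axis_def algebra_simps)
  next
    show "quadratic_form_matrix (polar_quadric (Const c * Var i * Var j * Var k) p) $ a $ b
        = 3 * ?T p (axis a 1) (axis b 1)" for p a b
      unfolding polar_quadric_monomial quadratic_form_matrix_add vector_add_component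
        quadratic_form_matrix_monomial
      by (simp add: algebra_simps)
  qed
  then show ?case by blast
qed

section \<open>Forms of rank at most two\<close>

context symmetric_bilinear
begin

text \<open>
  The plane spanned by \<open>p\<close> and \<open>w\<close> is hyperbolic and accounts for rank two already. If
  \<open>b u u \<noteq> 0\<close> for some \<open>u\<close> orthogonal to \<open>p\<close>, then the functionals \<open>b p\<close>, \<open>b w\<close>, \<open>b u\<close> are independent:
  evaluating a linear relation at \<open>p\<close> kills the coefficient of \<open>b w\<close>, and evaluating at \<open>u\<close> that of
  \<open>b u\<close>. Conversely, if the hyperplane orthogonal to \<open>p\<close> is totally isotropic, then for \<open>y\<close> in it the
  functional \<open>b y\<close> vanishes on the kernel of \<open>b p\<close> and so is a multiple of \<open>b p\<close>; hence \<open>b p\<close> and \<open>b w\<close>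
  span all functionals \<open>b x\<close>.
\<close>

lemma rank_le_two_iff_isotropic:
  fixes A :: "complex ^ 'n ^ 'n"
  assumes A: "\<And>i j. A $ i $ j = b (axis i 1) (axis j 1)"
    and p: "b p p = 0" and w: "b p w \<noteq> 0"
  shows "rank A \<le> 2 \<longleftrightarrow> (\<forall>u. b p u = 0 \<longrightarrow> b u u = 0)"
proof -
  \<comment> \<open>The functional \<open>b x\<close> as a row vector; the rows of \<open>A\<close> are those of the unit vectors.\<close>
  define \<beta> where "\<beta> x = (\<chi> j. b x (axis j 1))" for x
  have pair: "b x y = (\<Sum>j\<in>UNIV. \<beta> x $ j * y $ j)" for x y
    unfolding \<beta>_def using eq_sum_axis[of x y] by simp
  have rows: "rows A = range (\<lambda>i. \<beta> (axis i 1))"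
    by (auto simp: rows_def row_def \<beta>_def A vec_eq_iff)
  have in_span: "\<beta> x \<in> vec.span (rows A)" for x
  proof -
    have "\<beta> x = (\<Sum>i\<in>UNIV. x $ i *s \<beta> (axis i 1))"
      using eq_sum_axis[of _ x] by (simp add: vec_eq_iff \<beta>_def sym[of x] sym[of "axis _ 1" "axis _ 1"] mult.commute)
    also have "\<dots> \<in> vec.span (rows A)"
      unfolding rows by (intro vec.span_sum vec.span_scale vec.span_base) auto
    finally show ?thesis .
  qed
  show ?thesis
  proof (intro iffI allI impI)
    fix u assume rank: "rank A \<le> 2" and u: "b p u = 0"
    show "b u u = 0"
    proof (rule ccontr)
      assume uu: "b u u \<noteq> 0"
      have "\<beta> p \<noteq> 0"
        using w pair[of p w] by auto
      moreover have u_notin: "\<beta> u \<notin> vec.span {\<beta> p}"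
      proof
        assume "\<beta> u \<in> vec.span {\<beta> p}"
        then obtain k where "\<beta> u = k *s \<beta> p"
          by (auto simp: vec.span_singleton)
        then have "b u u = k * b p u"
          by (simp add: pair[of u] pair[of p] sum_distrib_left mult.assoc)
        with u uu show False by simp
      qed
      moreover have w_notin: "\<beta> w \<notin> vec.span {\<beta> u, \<beta> p}"
      proof
        assume "\<beta> w \<in> vec.span {\<beta> u, \<beta> p}"
        then obtain k l where "\<beta> w - k *s \<beta> u = l *s \<beta> p"
          by (auto simp: vec.span_insert[of "\<beta> u"] vec.span_singleton)
        then have "\<beta> w = k *s \<beta> u + l *s \<beta> p"
          by (simp add: algebra_simps)
        then have "b w p = k * b u p + l * b p p"
          by (simp only: pair vector_add_component vector_smult_component sum_distrib_left
              sum.distrib distrib_right mult.assoc)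
        with u w p show False by (simp add: sym[of u p] sym[of w p])
      qed
      ultimately have "vec.independent {\<beta> w, \<beta> u, \<beta> p}"
        by (intro vec.independent_insertI) (auto simp: vec.independent_empty)
      moreover have "card {\<beta> w, \<beta> u, \<beta> p} = 3"
        using u_notin w_notin by (auto simp: card_insert_if intro: vec.span_base)
      moreover have "{\<beta> w, \<beta> u, \<beta> p} \<subseteq> vec.span (rows A)"
        using in_span by auto
      ultimately have "3 \<le> vec.dim (vec.span (rows A))"
        by (metis vec.independent_card_le_dim)
      with rank show False by (simp add: row_rank_def_gen)
    qed
  next
    assume iso: "\<forall>u. b p u = 0 \<longrightarrow> b u u = 0"
    have orth: "b y z = 0" if "b p y = 0" "b p z = 0" for y z
    proof -
      have "b p (y + z) = 0"
        using that by (simp add: add_right)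
      then have "b (y + z) (y + z) = 0" "b y y = 0" "b z z = 0"
        using iso that by blast+
      then show ?thesis by (simp add: add_left add_right sym[of z y])
    qed
    have "\<beta> x \<in> vec.span {\<beta> p, \<beta> w}" for x
    proof -
      define y where "y = x - (b p x / b p w) *s w"
      have y: "b p y = 0"
        using w by (simp add: y_def diff_right scale_right)
      have proportional: "b y z = (b y w / b p w) * b p z" for z
      proof -
        have "b y (z - (b p z / b p w) *s w) = 0"
          by (rule orth[OF y]) (simp add: w diff_right scale_right)
        then show ?thesis by (simp add: diff_right scale_right)
      qed
      have "\<beta> y = (b y w / b p w) *s \<beta> p"
        unfolding vec_eq_iff \<beta>_def vec_lambda_beta vector_smult_component
        by (intro allI proportional)
      moreover have "\<beta> x = \<beta> y + (b p x / b p w) *s \<beta> w"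
        by (simp add: \<beta>_def vec_eq_iff y_def diff_left scale_left)
      ultimately show ?thesis
        by (auto intro!: vec.span_add vec.span_scale intro: vec.span_base)
    qed
    then have "vec.dim (rows A) \<le> card {\<beta> p, \<beta> w}"
      by (intro vec.dim_le_card) (auto simp: rows)
    also have "\<dots> \<le> 2" by (simp add: card_insert_if)
    finally show "rank A \<le> 2" by (simp add: row_rank_def_gen)
  qed
qed

end

section \<open>A cubic containing a hyperplane is singular\<close>

lemma complex_quadratic_root:
  fixes a b c :: complex
  assumes "a \<noteq> 0"
  obtains t where "a * t\<^sup>2 + b * t + c = 0"
proof -
  define d where "d = csqrt (b\<^sup>2 - 4 * a * c)"
  define t where "t = (d - b) / (2 * a)"
  have "4 * a * (a * t\<^sup>2 + b * t + c) = (2 * a * t + b)\<^sup>2 - (b\<^sup>2 - 4 * a * c)"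
    by (simp add: power2_eq_square algebra_simps)
  also have "2 * a * t + b = d"
    using assms by (simp add: t_def)
  finally have "a * t\<^sup>2 + b * t + c = 0"
    using assms by (simp add: d_def)
  with that show thesis by blast
qed

context symmetric_trilinear
begin

text \<open>
  If the cubic contains the hyperplane \<open>W\<close> given by \<open>T p p y = 0\<close>, then on \<open>W\<close> its gradient is
  normal to \<open>W\<close>, so only the derivative \<open>T x x w\<close> in one transversal direction \<open>w\<close> can be nonzero. This
  is a quadratic form on \<open>W\<close>, and its restriction to the line through \<open>u\<close> in direction \<open>p\<close> has the
  leading coefficient \<open>T p p w \<noteq> 0\<close>. It therefore has a zero on this line, which does not pass
  through the origin.
\<close>

lemma singular_point_if_vanishing_on_hyperplane:
  assumes vanish: "\<And>y. T p p y = 0 \<Longrightarrow> T y y y = 0"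
    and p: "T p p p = 0" and w: "T p p w \<noteq> 0"
    and u: "T p p u = 0" "\<And>c. u \<noteq> c *s p"
  shows "\<exists>x. x \<noteq> 0 \<and> (\<forall>z. T x x z = 0)"
proof -
  have polar: "T y y z = 0" if "T p p y = 0" "T p p z = 0" for y z
  proof -
    have neg: "T (- a) c d = - T a c d" "T a (- c) d = - T a c d" "T a c (- d) = - T a c d" for a c d
    proof -
      show "T a c (- d) = - T a c d" "T a (- c) d = - T a c d" for a c
        using slice.diff_right[of a c 0 d] slice.diff_left[of a 0 c d] by simp_all
      from this(2)[of c a] show "T (- a) c d = - T a c d"
        by (simp only: swap12[of _ c d])
    qed
    have "T p p (y + z) = 0" "T p p (y + - z) = 0"
      using that by (simp_all only: slice.add_right neg) simp_all
    then have "T (y + z) (y + z) (y + z) = 0" "T (y + - z) (y + - z) (y + - z) = 0"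
      "T y y y = 0" "T z z z = 0"
      using that by (simp_all only: vanish)
    \<comment> \<open>The parts of the cubic that are odd and even in \<open>z\<close> vanish separately.\<close>
    then have "3 * T y y z + 3 * T y z z = 0" "- (3 * T y y z) + 3 * T y z z = 0"
      by (simp_all only: cube_add neg) simp_all
    moreover have "6 * T y y z = (3 * T y y z + 3 * T y z z) - (- (3 * T y y z) + 3 * T y z z)"
      by simp
    ultimately show ?thesis by simp
  qed
  obtain t where t: "T p p w * t\<^sup>2 + 2 * T p u w * t + T u u w = 0"
    using complex_quadratic_root[OF w] by blast
  define x where "x = u + t *s p"
  have "T p p x = 0"
    using p u(1) by (simp add: x_def slice.add_right slice.scale_right)
  moreover have "T x x w = 0"
    using t by (simp add: x_def add scale slice.add_left slice.scale_left swap12[of u p]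
        power2_eq_square algebra_simps)
  ultimately have "T x x z = 0" for z
  proof -
    have "T x x (z - (T p p z / T p p w) *s w) = 0"
      by (rule polar[OF \<open>T p p x = 0\<close>]) (simp add: w slice.diff_right slice.scale_right)
    then show ?thesis using \<open>T x x w = 0\<close> by (simp add: slice.diff_right slice.scale_right)
  qed
  moreover have "x \<noteq> 0"
  proof
    assume "x = 0"
    then have "u = (- t) *s p" by (simp add: x_def add_eq_0_iff2)
    with u(2) show False by blast
  qed
  ultimately show ?thesis by blast
qed

end

section \<open>Affine charts of a hyperplane\<close>

text \<open>
  A basis of the hyperplane that contains \<open>p\<close> becomes a basis of the whole space when a vector outside
  the hyperplane is added, which gives the number of its elements; the ones other than \<open>p\<close>
  form the chart.
\<close>

lemma hyperplane_affine_chart_exists: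
  fixes a :: "'n::finite \<Rightarrow> complex" and p :: "complex ^ 'n"
  assumes a: "a i \<noteq> 0" and p: "p \<noteq> 0" "(\<Sum>j\<in>UNIV. a j * p $ j) = 0"
    and dim: "CARD('n) = CARD('k::finite) + 2"
  shows "\<exists>v :: 'k \<Rightarrow> complex ^ 'n. affine_chart {y. (\<Sum>j\<in>UNIV. a j * y $ j) = 0} p v"
proof -
  define L where "L y = (\<Sum>j\<in>UNIV. a j * y $ j)" for y :: "complex ^ 'n"
  define W where "W = {y. L y = 0}"
  have L_add: "L (x + y) = L x + L y" for x y
    by (simp add: L_def distrib_left sum.distrib)
  have L_scale: "L (c *s x) = c * L x" for c x
    by (simp add: L_def sum_distrib_left mult_ac)
  have L_diff: "L (x - y) = L x - L y" for x y
    using L_add[of "x - y" y] by simp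
  have W: "vec.subspace W"
    unfolding W_def by (intro vec.subspaceI) (simp_all add: L_add L_scale, simp add: L_def)
  define w :: "complex ^ 'n" where "w = axis i 1"
  have w: "L w = a i"
    by (simp add: L_def w_def axis_def if_distrib cong: if_cong)
  obtain B where B: "{p} \<subseteq> B" "B \<subseteq> W" "vec.independent B" "W \<subseteq> vec.span B"
    using vec.maximal_independent_subset_extend[of "{p}" W] p by (auto simp: W_def L_def)
  have span_B: "vec.span B = W"
    using B W by (intro antisym vec.span_minimal) auto
  have w_notin: "w \<notin> W" using a w by (simp add: W_def)
  have "x \<in> vec.span (insert w B)" for x
  proof -
    have "L (x - (L x / a i) *s w) = 0"
      using a by (simp add: L_diff L_scale w)
    then show ?thesis
      unfolding vec.span_insert span_B W_def by blast
  qed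
  moreover have "vec.independent (insert w B)"
    using B(3) w_notin span_B by (intro vec.independent_insertI) (auto simp: vec.independent_empty)
  ultimately have "card (insert w B) = CARD('n)"
    using vec.basis_card_eq_dim[of "insert w B" UNIV] by (auto simp: card_cart_basis)
  moreover have "finite B" using B(3) by (rule vec.finiteI_independent)
  moreover have "w \<notin> B" using w_notin B(2) by auto
  ultimately have "card (B - {p}) = CARD('k)"
    using dim B(1) by simp
  then obtain v :: "'k \<Rightarrow> complex ^ 'n" where v: "bij_betw v UNIV (B - {p})"
    using finite_same_card_bij[of "UNIV :: 'k set" "B - {p}"] \<open>finite B\<close> by auto
  then have "insert p (range v) = B"
    using B(1) by (auto simp: bij_betw_def)
  then have "affine_chart W p v"
    using v B(3) span_B by (auto simp: affine_chart_def bij_betw_def)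
  then show ?thesis unfolding W_def L_def by blast
qed

lemma affine_chart_coordinates:
  fixes v :: "'k::finite \<Rightarrow> complex ^ 'n::finite"
  assumes "affine_chart W p v" "u \<in> W"
  obtains c s where "u = c *s p + (\<Sum>j\<in>UNIV. (s :: complex ^ 'k) $ j *s v j)"
proof -
  have "u \<in> vec.span (insert p (range v))" and inj: "inj v"
    using assms by (auto simp: affine_chart_def)
  then obtain c where "u - c *s p \<in> vec.span (range v)"
    by (auto simp: vec.span_insert)
  then obtain h where "u - c *s p = (\<Sum>x\<in>range v. h x *s x)"
    using vec.span_finite[of "range v"] by auto
  then have "u = c *s p + (\<Sum>j\<in>UNIV. (\<chi> j. h (v j)) $ j *s v j)"
    by (simp add: sum.reindex[OF inj] algebra_simps)
  with that show thesis by blast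
qed

lemma affine_chart_combination_in:
  assumes "affine_chart W p v"
  shows "(\<Sum>j\<in>UNIV. (s :: complex ^ 'k::finite) $ j *s v j) \<in> W"
proof -
  have W: "W = vec.span (insert p (range v))"
    using assms by (simp add: affine_chart_def)
  show ?thesis
    unfolding W by (intro vec.span_sum vec.span_scale vec.span_base) auto
qed

lemma affine_chart_not_multiple:
  assumes "affine_chart W p v"
  shows "v j \<noteq> c *s p"
proof
  assume *: "v j = c *s p"
  have "p \<noteq> v j" "vec.independent (insert p (range v))"
    using assms by (auto simp: affine_chart_def)
  then have "v j \<notin> vec.span (insert p (range v) - {v j})"
    unfolding vec.dependent_def by blast
  moreover have "v j \<in> vec.span (insert p (range v) - {v j})"
    using * \<open>p \<noteq> v j\<close> by (auto intro!: vec.span_scale intro: vec.span_base)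
  ultimately show False by blast
qed

section \<open>Eckardt points and polar quadrics\<close>

text \<open>
  In the chart the cubic reads
  \<open>T (p + y) (p + y) (p + y) = T p p p + 3 T p p y + 3 T p y y + T y y y\<close> with \<open>y\<close> in the span of
  the \<open>v j\<close>. The first two terms vanish since \<open>p\<close> lies on the cubic and \<open>y\<close> in the tangent space, and
  the other two are the components of degree two and three. Replacing this span by all of \<open>W\<close> is
  harmless: adding a multiple of \<open>p\<close> to \<open>y\<close> leaves \<open>T p y y\<close> unchanged, and it changes \<open>T y y y\<close>
  only by a multiple of \<open>T p y y\<close>.
\<close>

lemma (in symmetric_trilinear) order_local_equation_eq_3_iff:
  fixes v :: "'k::finite \<Rightarrow> complex ^ 'n"
  assumes f: "\<And>x. eval_poly f x = T x x x"
    and W: "\<And>y. y \<in> W \<longleftrightarrow> T p p y = 0" and p: "T p p p = 0"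
    and chart: "affine_chart W p v"
  shows "order_at_origin (local_equation f p v) = 3 \<longleftrightarrow>
    (\<forall>u\<in>W. T p u u = 0) \<and> (\<exists>u\<in>W. T u u u \<noteq> 0)"
proof -
  define y where "y s = (\<Sum>j\<in>UNIV. s $ j *s v j)" for s :: "complex ^ 'k"
  have y_W: "y s \<in> W" for s
    unfolding y_def by (rule affine_chart_combination_in[OF chart])
  then have ppy: "T p p (y s) = 0" for s using W by blast
  have mod_p: "\<exists>c s. T p u u = T p (y s) (y s) \<and>
      T u u u = 3 * c * T p (y s) (y s) + T (y s) (y s) (y s)" if u_W: "u \<in> W" for u
  proof (rule affine_chart_coordinates[OF chart u_W])
    fix c s assume "u = c *s p + (\<Sum>j\<in>UNIV. s $ j *s v j)"
    then have u: "u = c *s p + y s" by (simp add: y_def)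
    have "T p u u = T p (y s) (y s)"
      using p ppy[of s] swap23[of p "y s" p]
      by (simp add: u slice.add_left slice.add_right slice.scale_left slice.scale_right)
    moreover have "T u u u = 3 * c * T p (y s) (y s) + T (y s) (y s) (y s)"
      unfolding u cube_add using p ppy by (simp add: scale slice.scale_left slice.scale_right)
    ultimately show ?thesis by blast
  qed
  define P where "P s = [:0, 0, 3 * T p (y s) (y s), T (y s) (y s) (y s):]" for s
  have "eval_poly (local_equation f p v) (t *s s) = poly (P s) t" for s t
  proof -
    have "(\<Sum>j\<in>UNIV. (t *s s) $ j *s v j) = t *s y s"
      by (simp add: y_def vec.scale_sum_right)
    then have "eval_poly (local_equation f p v) (t *s s) = T (p + t *s y s) (p + t *s y s) (p + t *s y s)"
      by (simp add: eval_local_equation f)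
    also have "\<dots> = poly (P s) t"
      unfolding cube_add using p ppy
      by (simp add: P_def scale slice.scale_left slice.scale_right algebra_simps)
    finally show ?thesis .
  qed
  then have "order_at_origin (local_equation f p v) = enat 3 \<longleftrightarrow>
      (\<forall>k<3. \<forall>s. coeff (P s) k = 0) \<and> (\<exists>s. coeff (P s) 3 \<noteq> 0)"
    by (rule order_at_origin_radial)
  also have "\<dots> \<longleftrightarrow> (\<forall>s. T p (y s) (y s) = 0) \<and> (\<exists>s. T (y s) (y s) (y s) \<noteq> 0)"
    by (simp add: P_def numeral_3_eq_3 All_less_Suc)
  also have "\<dots> \<longleftrightarrow> (\<forall>u\<in>W. T p u u = 0) \<and> (\<exists>u\<in>W. T u u u \<noteq> 0)"
  proof -
    have "(\<forall>s. T p (y s) (y s) = 0) \<longleftrightarrow> (\<forall>u\<in>W. T p u u = 0)"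
    proof
      assume zero: "\<forall>s. T p (y s) (y s) = 0"
      show "\<forall>u\<in>W. T p u u = 0"
      proof
        fix u assume "u \<in> W"
        from mod_p[OF this] zero show "T p u u = 0" by auto
      qed
    qed (use y_W in blast)
    moreover have "(\<exists>s. T (y s) (y s) (y s) \<noteq> 0) \<longleftrightarrow> (\<exists>u\<in>W. T u u u \<noteq> 0)"
      if zero: "\<forall>s. T p (y s) (y s) = 0"
    proof
      assume "\<exists>u\<in>W. T u u u \<noteq> 0"
      then obtain u where "u \<in> W" "T u u u \<noteq> 0" by blast
      with mod_p[of u] zero show "\<exists>s. T (y s) (y s) (y s) \<noteq> 0" by auto
    qed (use y_W in blast)
    ultimately show ?thesis by blast
  qed
  finally show ?thesis by (simp add: numeral_eq_enat)
qed

theorem lemma3p14: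
  fixes f :: "5 cpoly" and p :: "complex ^ 5"
  assumes "smooth_cubic_threefold f"
    and "p \<in> hypersurface f"
  shows "eckardt_point f p \<longleftrightarrow> quadric_rank (polar_quadric f p) \<le> 2"
proof -
  have hom: "homogeneous 3 f"
    and smooth: "\<And>x. x \<in> hypersurface f \<Longrightarrow> \<exists>i. eval_poly (partial_deriv i f) x \<noteq> 0"
    using assms(1) by (auto simp: smooth_cubic_threefold_def)
  obtain T where "polarization f T"
    using polarization_exists[OF hom] by blast
  then have trilinear: "symmetric_trilinear T"
    and f: "\<And>x. eval_poly f x = T x x x"
    and df: "\<And>l x. eval_poly (partial_deriv l f) x = 3 * T x x (axis l 1)"
    and polar: "\<And>a b. quadratic_form_matrix (polar_quadric f p) $ a $ b = 3 * T p (axis a 1) (axis b 1)"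
    by (auto simp: polarization_def)
  interpret symmetric_trilinear T by (rule trilinear)
  \<comment> \<open>The bilinear form of the polar quadric; the tangent space is orthogonal to \<open>p\<close> under it.\<close>
  interpret q: symmetric_bilinear "\<lambda>y z. 3 * T p y z" by (rule symmetric_bilinear_slice)
  define W where "W = tangent_space f p"
  have W: "y \<in> W \<longleftrightarrow> T p p y = 0" for y
    unfolding W_def tangent_space_def by (simp add: df q.eq_sum_axis[of p y, symmetric])
  have p: "p \<noteq> 0" "T p p p = 0"
    using assms(2) by (auto simp: hypersurface_def f)
  obtain i where i: "eval_poly (partial_deriv i f) p \<noteq> 0"
    using smooth assms(2) by blast
  define w :: "complex ^ 5" where "w = axis i 1"
  have w: "T p p w \<noteq> 0"
    using i by (simp add: df w_def)
  have chart_exists: "\<exists>v :: 3 \<Rightarrow> complex ^ 5. affine_chart W p v"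
    using hyperplane_affine_chart_exists
        [where 'k = 3 and a = "\<lambda>i. eval_poly (partial_deriv i f) p", OF i p(1)] W[of p] p(2)
    by (simp add: W_def tangent_space_def)
  \<comment> \<open>Smoothness excludes multiplicity greater than three: the tangent space is not contained in \<open>X\<close>.\<close>
  have not_contained: "\<exists>u\<in>W. T u u u \<noteq> 0" if chart: "affine_chart W p v" for v :: "3 \<Rightarrow> complex ^ 5"
  proof (rule ccontr)
    assume "\<not> (\<exists>u\<in>W. T u u u \<noteq> 0)"
    then have vanish: "T y y y = 0" if "T p p y = 0" for y
      using that by (auto simp: W)
    have "v 0 \<in> W"
      using chart by (auto simp: affine_chart_def intro: vec.span_base)
    then obtain x where x: "x \<noteq> 0" "\<And>z. T x x z = 0"
      using singular_point_if_vanishing_on_hyperplane[OF vanish p(2) w, of "v 0"]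
        affine_chart_not_multiple[OF chart] by (auto simp: W)
    then have "x \<in> hypersurface f"
      by (simp add: hypersurface_def f)
    with smooth x(2) show False by (auto simp: df)
  qed
  have "eckardt_point f p \<longleftrightarrow> (\<forall>u\<in>W. T p u u = 0)"
    unfolding eckardt_point_def tangent_section_multiplicity_def W_def[symmetric]
    using assms(2) chart_exists not_contained order_local_equation_eq_3_iff[OF f W p(2)] by blast
  also have "\<dots> \<longleftrightarrow> quadric_rank (polar_quadric f p) \<le> 2"
    unfolding quadric_rank_def using q.rank_le_two_iff_isotropic[OF polar, of p w] p w
    by (auto simp: W)
  finally show ?thesis .
qed

end
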